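(* Let $\alpha:A^{\Delta}\to(H,V)$ be a homomorphism into a finite forest algebra whose horizontal monoid $H$ is idempotent and commutative. Then $\alpha$ is an $(\mathsf{EF},\mathsf{EX})$-homomorphism if and only if it is nonconfusing.
   Context: $A^{\Delta}=(H_A,V_A)$ is the free forest algebra over the finite alphabet $A$: $H_A$ is the monoid of forests (finite ordered sequences of finite ordered $A$-labelled trees) under concatenation $+$; $V_A$ the monoid of contexts (forests with one leaf replaced by a hole) under substitution, acting on $H_A$ by substitution. $as$ denotes the tree with root $a$ and child forest $s$. A forest algebra $(H,V)$ is an additive monoid $H$, a monoid $V$, and a faithful left action of $V$ on $H$ such that the maps $g\mapsto g+h$, $g\mapsto h+g$ lie in $V$; homomorphisms preserve everything and homomorphisms from $A^{\Delta}$ are determined by the images of $a\square$. When $H$ is idempotent and commutative, the sum $\infty$ of all its elements is absorbing. $\beta$ factors through $\alpha$ if $\alpha(s)=\alpha(s')$ implies $\beta(s)=\beta(s')$ for forests $s,s'$. Wreath product: $(H_1,V_1)\circ(H_2,V_2)=(H_1\times H_2,V_1\times V_2^{H_1})$, componentwise addition, $(v,f)(h_1,h_2)=(vh_1,f(h_1)h_2)$. For $\alpha:A^{\Delta}\to(H_1,V_1)$, $\beta:(A\times H_1)^{\Delta}\to(H_2,V_2)$, $\alpha\otimes\beta(a)=(\alpha(a),h\mapsto\beta(a,h))$; then $\alpha\otimes\beta(s)=(\alpha(s),\beta(s^{\alpha}))$ where $s^{\alpha}$ relabels each node whose subtree is $at$ by $(a,\alpha(t))$. Iterated products $\beta_1\otimes\cdots\otimes\beta_k$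 with $\beta_i:(A\times H_1\times\cdots\times H_{i-1})^{\Delta}\to(H_i,V_i)$ are formed likewise. A homomorphism is 1-definite if the value of a forest depends only on the set of labels of its root nodes. ${\cal U}_1=(\{0,\infty\},\{1,0\})$, $1$ the identity, $0$ the constant map to $\infty$. An $(\mathsf{EF},\mathsf{EX})$-homomorphism is one that factors through some $\beta_1\otimes\cdots\otimes\beta_k$ where each $\beta_i$ maps into ${\cal U}_1$ or is 1-definite. Reachability: $h\le h'$ iff $h=vh'$ for some $v\in V$; reachability classes are the classes of $h\cong h'$ (both $h\le h'$ and $h'\le h$), partially ordered by $\le$; $h>\Gamma$ means the class of $h$ is strictly above $\Gamma$. For a class $\Gamma$, let $I_\Gamma=\{h\in H:h\not>\Gamma\}$ and let $\alpha_\Gamma:A^{\Delta}\to(H_\Gamma,V_\Gamma)$ be the quotient of $\alpha$ in which all elements of $I_\Gamma$ are identified to a single (absorbing) element $\infty$ (forests $s,s'$ identified iff $\alpha(s)=\alpha(s')\notin I_\Gamma$ or $\alpha(s),\alpha(s')\in I_\Gamma$). For any finite alphabet $B$, equivalences $\sim_k$ on $H_B$: $\sim_0$ identifies all forests; for $s=b_1s_1+\cdots+b_rs_r$, let $T^{k+1}_s=\{(b_i,[s_i]_{\sim_k}):1\le i\le r\}$ and $s\sim_{k+1}s'$ iff $T^{k+1}_s=T^{k+1}_{s'}$. For $k>0$ and a reachability class $\Gamma$, forests $s_1,s_2\in H_A$ satisfy $s_1\equiv_{\alpha,k,\Gamma}s_2$ if $(s_1)^{\alpha_\Gamma}\sim_k(s_2)^{\alpha_\Gamma}$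 (as forests over $A\times H_\Gamma$) and $\alpha(s_1),\alpha(s_2)\in\Gamma$. $\alpha$ is nonconfusing (with parameter $k$) if there is $k>0$ such that for every reachability class $\Gamma$, $s_1\equiv_{\alpha,k,\Gamma}s_2$ implies $\alpha(s_1)=\alpha(s_2)$.
   Formalization: The homomorphism α is additionally assumed surjective onto (H,V) (every h and every v is the image of a forest, resp. context); otherwise the claim fails, e.g. for "contains a" mapped into ({0,∞}, all maps), which is an (EF,EX)-homomorphism but confusing. *)

theory Defs
  imports Main
begin

datatype 'a tree = Node 'a "'a tree list"

type_synonym 'a forest = "'a tree list"

fun root :: "'a tree \<Rightarrow> 'a" where
  "root (Node a s) = a"

fun kids :: "'a tree \<Rightarrow> 'a forest" where
  "kids (Node a s) = s"

datatype 'a ctx = CHole "'a forest" "'a forest"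
  | CNode "'a forest" 'a "'a ctx" "'a forest"

fun fill :: "'a ctx \<Rightarrow> 'a forest \<Rightarrow> 'a forest" where
  "fill (CHole l r) t = l @ t @ r"
| "fill (CNode l a c r) t = l @ [Node a (fill c t)] @ r"

text \<open>A forest algebra \<open>(H,V)\<close>: \<open>H\<close> a monoid (carrier \<open>H\<close>, operation \<open>add\<close>, unit \<open>zero\<close>),
  \<open>V\<close> a monoid of transformations of \<open>H\<close> (faithful action; two functions are regarded
  as the same element of \<open>V\<close> when they agree on \<open>H\<close>), containing all translations.\<close>

definition forest_algebra ::
  "'h set \<Rightarrow> ('h \<Rightarrow> 'h \<Rightarrow> 'h) \<Rightarrow> 'h \<Rightarrow> ('h \<Rightarrow> 'h) set \<Rightarrow> bool" where
  "forest_algebra H add zero V \<longleftrightarrow>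
     zero \<in> H \<and>
     (\<forall>g\<in>H. \<forall>h\<in>H. add g h \<in> H) \<and>
     (\<forall>f\<in>H. \<forall>g\<in>H. \<forall>h\<in>H. add (add f g) h = add f (add g h)) \<and>
     (\<forall>h\<in>H. add zero h = h \<and> add h zero = h) \<and>
     (\<forall>v\<in>V. \<forall>h\<in>H. v h \<in> H) \<and>
     (\<exists>v\<in>V. \<forall>h\<in>H. v h = h) \<and>
     (\<forall>v\<in>V. \<forall>w\<in>V. v \<circ> w \<in> V) \<and>
     (\<forall>h\<in>H. (\<exists>v\<in>V. \<forall>g\<in>H. v g = add g h) \<and> (\<exists>v\<in>V. \<forall>g\<in>H. v g = add h g))"

text \<open>A homomorphism from the free forest algebra \<open>A\<^sup>\<Delta>\<close>, given by its action on forests;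
  it is determined by the images \<open>f a\<close> of the contexts \<open>a[]\<close>.\<close>

definition forest_hom ::
  "'h set \<Rightarrow> ('h \<Rightarrow> 'h \<Rightarrow> 'h) \<Rightarrow> 'h \<Rightarrow> ('h \<Rightarrow> 'h) set \<Rightarrow> ('a forest \<Rightarrow> 'h) \<Rightarrow> bool" where
  "forest_hom H add zero V \<alpha> \<longleftrightarrow>
     forest_algebra H add zero V \<and>
     (\<forall>s. \<alpha> s \<in> H) \<and>
     \<alpha> [] = zero \<and>
     (\<forall>s t. \<alpha> (s @ t) = add (\<alpha> s) (\<alpha> t)) \<and>
     (\<exists>f. (\<forall>a. f a \<in> V) \<and> (\<forall>a s. \<alpha> [Node a s] = f a (\<alpha> s)))"

definition forest_hom_surj ::
  "'h set \<Rightarrow> ('h \<Rightarrow> 'h) set \<Rightarrow> ('a forest \<Rightarrow> 'h) \<Rightarrow> bool" where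
  "forest_hom_surj H V \<alpha> \<longleftrightarrow>
     H \<subseteq> range \<alpha> \<and> (\<forall>v\<in>V. \<exists>c. \<forall>t. v (\<alpha> t) = \<alpha> (fill c t))"

fun relabel_tree :: "('a forest \<Rightarrow> 'v) \<Rightarrow> 'a tree \<Rightarrow> ('a \<times> 'v) tree" where
  "relabel_tree f (Node a s) = Node (a, f s) (map (relabel_tree f) s)"

definition relabel :: "('a forest \<Rightarrow> 'v) \<Rightarrow> 'a forest \<Rightarrow> ('a \<times> 'v) forest" where
  "relabel f s = map (relabel_tree f) s"

text \<open>The forest algebra \<open>U\<^sub>1\<close>, encoded over \<open>nat\<close>: \<open>0\<close> is the element \<open>0\<close>, \<open>1\<close> is \<open>infty\<close>;
  the identity is \<open>id\<close>, the constant map to \<open>infty\<close> is \<open>\<lambda>g. max g 1\<close> (constant on \<open>H\<close>).\<close>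

definition U1_hom :: "('b forest \<Rightarrow> nat) \<Rightarrow> bool" where
  "U1_hom \<beta> \<longleftrightarrow> forest_hom {0, 1} max 0 {id, \<lambda>g. max g 1} \<beta>"

text \<open>A 1-definite homomorphism (into some forest algebra; the carrier is taken inside \<open>nat\<close>,
  which loses nothing since one may always pass to the countable image subalgebra).\<close>

definition one_definite_hom :: "('b forest \<Rightarrow> nat) \<Rightarrow> bool" where
  "one_definite_hom \<beta> \<longleftrightarrow>
     (\<exists>H add zero V. forest_hom H add zero V \<beta>) \<and>
     (\<forall>s s'. set (map root s) = set (map root s') \<longrightarrow> \<beta> s = \<beta> s')"

text \<open>Iterated wreath product \<open>\<beta>\<^sub>1 x \<dots> x \<beta>\<^sub>k\<close> on forests.  The layer \<open>\<beta>\<^sub>i\<close> reads forests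
  over \<open>A \<times> H\<^sub>1 \<times> \<dots> \<times> H\<^sub>i\<^sub>-\<^sub>1\<close>, the tuple of previous values being a list.
  \<open>casc_rev\<close> takes the layers in reverse order (last layer first).\<close>

primrec casc_rev :: "((('a \<times> nat list) forest \<Rightarrow> nat)) list \<Rightarrow> 'a forest \<Rightarrow> nat list" where
  "casc_rev [] = (\<lambda>t. [])"
| "casc_rev (b # bs) = (\<lambda>t. casc_rev bs t @ [b (relabel (casc_rev bs) t)])"

definition cascade :: "((('a \<times> nat list) forest \<Rightarrow> nat)) list \<Rightarrow> 'a forest \<Rightarrow> nat list" where
  "cascade bs = casc_rev (rev bs)"

definition factors_through :: "('a forest \<Rightarrow> 'h) \<Rightarrow> ('a forest \<Rightarrow> 'k) \<Rightarrow> bool" where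
  "factors_through \<beta> \<alpha> \<longleftrightarrow> (\<forall>s s'. \<alpha> s = \<alpha> s' \<longrightarrow> \<beta> s = \<beta> s')"

definition EF_EX_hom :: "('a forest \<Rightarrow> 'h) \<Rightarrow> bool" where
  "EF_EX_hom \<alpha> \<longleftrightarrow>
     (\<exists>bs. (\<forall>b\<in>set bs. U1_hom b \<or> one_definite_hom b) \<and> factors_through \<alpha> (cascade bs))"

definition reach :: "('h \<Rightarrow> 'h) set \<Rightarrow> 'h \<Rightarrow> 'h \<Rightarrow> bool" where
  "reach V h h' \<longleftrightarrow> (\<exists>v\<in>V. h = v h')"

definition reach_classes :: "'h set \<Rightarrow> ('h \<Rightarrow> 'h) set \<Rightarrow> 'h set set" where
  "reach_classes H V = {{h' \<in> H. reach V h h' \<and> reach V h' h} | h. h \<in> H}"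

definition above :: "('h \<Rightarrow> 'h) set \<Rightarrow> 'h \<Rightarrow> 'h set \<Rightarrow> bool" where
  "above V h \<Gamma> \<longleftrightarrow> (\<exists>g\<in>\<Gamma>. reach V g h \<and> \<not> reach V h g)"

definition I_set :: "'h set \<Rightarrow> ('h \<Rightarrow> 'h) set \<Rightarrow> 'h set \<Rightarrow> 'h set" where
  "I_set H V \<Gamma> = {h \<in> H. \<not> above V h \<Gamma>}"

text \<open>\<open>\<alpha>\<^sub>\<Gamma>\<close>: the elements of \<open>I\<^sub>\<Gamma>\<close> are collapsed to \<open>None\<close> (playing the role of \<open>infty\<close>).\<close>

definition alpha_Gamma ::
  "'h set \<Rightarrow> ('h \<Rightarrow> 'h) set \<Rightarrow> 'h set \<Rightarrow> ('a forest \<Rightarrow> 'h) \<Rightarrow> 'a forest \<Rightarrow> 'h option" where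
  "alpha_Gamma H V \<Gamma> \<alpha> s = (if \<alpha> s \<in> I_set H V \<Gamma> then None else Some (\<alpha> s))"

fun sim_k :: "nat \<Rightarrow> 'b forest \<Rightarrow> 'b forest \<Rightarrow> bool" where
  "sim_k 0 s s' = True"
| "sim_k (Suc k) s s' =
     ((\<lambda>t. (root t, {u. sim_k k (kids t) u})) ` set s =
      (\<lambda>t. (root t, {u. sim_k k (kids t) u})) ` set s')"

definition equiv_akG ::
  "'h set \<Rightarrow> ('h \<Rightarrow> 'h) set \<Rightarrow> ('a forest \<Rightarrow> 'h) \<Rightarrow> nat \<Rightarrow> 'h set \<Rightarrow> 'a forest \<Rightarrow> 'a forest \<Rightarrow> bool" where
  "equiv_akG H V \<alpha> k \<Gamma> s1 s2 \<longleftrightarrow>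
     sim_k k (relabel (alpha_Gamma H V \<Gamma> \<alpha>) s1) (relabel (alpha_Gamma H V \<Gamma> \<alpha>) s2) \<and>
     \<alpha> s1 \<in> \<Gamma> \<and> \<alpha> s2 \<in> \<Gamma>"

definition nonconfusing :: "'h set \<Rightarrow> ('h \<Rightarrow> 'h) set \<Rightarrow> ('a forest \<Rightarrow> 'h) \<Rightarrow> bool" where
  "nonconfusing H V \<alpha> \<longleftrightarrow>
     (\<exists>k>0. \<forall>\<Gamma>\<in>reach_classes H V. \<forall>s1 s2.
        equiv_akG H V \<alpha> k \<Gamma> s1 s2 \<longrightarrow> \<alpha> s1 = \<alpha> s2)"

end

theory Submission
  imports Defs "HOL-Library.Countable" "HOL-Library.Nat_Bijection" "HOL-Library.FuncSet"
begin

text \<open>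
  Let \<open>\<alpha>\<close> factor through a cascade of \<open>n\<close> layers. The value of a \<open>U\<^sub>1\<close> layer can only grow when a
  context is applied, so every class contains the value of some forest \<open>u\<close> at which all \<open>U\<^sub>1\<close>
  layers are stable: they do not change under contexts that keep \<open>\<alpha>\<close> in the class of \<open>\<alpha> u\<close>.
  If \<open>s\<close>, \<open>s'\<close> have values in this class and are equivalent to depth \<open>k \<ge> n\<close>, then there are forests
  \<open>r\<close>, \<open>r'\<close> with the same values that differ only in subforests at depth \<open>k\<close>, all of which contain
  \<open>u\<close>. Every \<open>U\<^sub>1\<close> layer is constant on the forests containing \<open>u\<close>, and every 1-definite layer
  looks one level deeper, so that the cascade cannot distinguish \<open>r\<close> from \<open>r'\<close>.

  Conversely, a cascade that computes \<open>\<alpha>\<close> on the values strictly above a class is extended so as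
  to cover the class itself. Equivalence to depth \<open>k + 1\<close> is computed by 1-definite layers, and it
  determines the value on forests in or above the class. Leaving this set of forests happens at a
  minimal subforest, where it is visible in the roots, so a final \<open>U\<^sub>1\<close> layer detects it.
\<close>

section \<open>Forests\<close>

lemma Node_root_kids [simp]: "Node (root t) (kids t) = t"
  by (cases t) simp

lemma tree_eq_iff: "t = t' \<longleftrightarrow> root t = root t' \<and> kids t = kids t'"
  by (metis Node_root_kids)

lemma forest_induct [case_names forest]:
  assumes "\<And>s. (\<And>t. t \<in> set s \<Longrightarrow> P (kids t)) \<Longrightarrow> P s"
  shows "P s"
proof -
  have "P (kids t)" for t :: "'a tree"
    by (induction t) (simp add: assms)
  from this[of "Node undefined s"] show ?thesis by simp
qed

lemma root_relabel_tree [simp]: "root (relabel_tree f t) = (root t, f (kids t))"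
  by (cases t) simp

lemma kids_relabel_tree [simp]: "kids (relabel_tree f t) = relabel f (kids t)"
  by (cases t) (simp add: relabel_def)

lemma set_relabel: "set (relabel f s) = relabel_tree f ` set s"
  by (simp add: relabel_def)

lemma relabel_Node: "relabel f [Node a s] = [Node (a, f s) (relabel f s)]"
  by (simp add: relabel_def)

lemma relabel_append: "relabel f (s @ t) = relabel f s @ relabel f t"
  by (simp add: relabel_def)

lemma root_map_tree [simp]: "root (map_tree g t) = g (root t)"
  by (cases t) simp

lemma relabel_tree_comp: "relabel_tree (F \<circ> f) t = map_tree (map_prod id F) (relabel_tree f t)"
  by (induction t) (simp add: relabel_def)

definition labels :: "'a forest \<Rightarrow> 'a set" where
  "labels s = (\<Union>t\<in>set s. set_tree t)"

lemma set_tree_eq_insert_labels: "set_tree t = insert (root t) (labels (kids t))"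
  by (cases t) (simp add: labels_def)

lemma labels_append: "labels (s @ t) = labels s \<union> labels t"
  by (simp add: labels_def)

lemma labels_Node: "labels [Node a s] = insert a (labels s)"
  by (simp add: labels_def)

lemma labels_relabel:
  "labels (relabel f s) = (\<Union>t\<in>set s. insert (root t, f (kids t)) (labels (relabel f (kids t))))"
  unfolding labels_def[of "relabel f s"] by (simp add: set_relabel set_tree_eq_insert_labels)

lemma roots_relabel_comp:
  "root ` set (relabel (F \<circ> f) s) = map_prod id F ` root ` set (relabel f s)"
  by (simp add: set_relabel image_image)

lemma labels_relabel_comp:
  "labels (relabel (F \<circ> f) s) = map_prod id F ` labels (relabel f s)"
  by (simp add: labels_def set_relabel relabel_tree_comp tree.set_map image_UN)

inductive occurs_in :: "'a forest \<Rightarrow> 'a forest \<Rightarrow> bool" for u where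
  refl: "occurs_in u u"
| append: "occurs_in u s \<Longrightarrow> occurs_in u (l @ s @ r)"
| Node: "occurs_in u s \<Longrightarrow> occurs_in u [Node a s]"

lemma occurs_in_trans:
  assumes "occurs_in s t" and "occurs_in u s"
  shows "occurs_in u t"
  using assms by induction (auto intro: occurs_in.intros)

lemma occurs_in_fill: "occurs_in u (fill c u)"
proof (induction c)
  case (CHole l r)
  then show ?case by (simp add: occurs_in.intros)
next
  case (CNode l a c r)
  then show ?case using occurs_in.append[OF occurs_in.Node] by simp
qed

lemma occurs_in_kids:
  assumes "t \<in> set s"
  shows "occurs_in (kids t) s"
proof -
  obtain l r where "s = l @ [Node (root t) (kids t)] @ r"
    using assms by (auto dest: split_list)
  then show ?thesis by (simp only: occurs_in.intros)
qed

lemma occurs_in_Cons: "occurs_in u s \<Longrightarrow> occurs_in u (t # s)"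
  using occurs_in.append[of u s "[t]" "[]"] by simp

lemma occurs_in_relabel: "occurs_in u s \<Longrightarrow> occurs_in (relabel f u) (relabel f s)"
  by (induction rule: occurs_in.induct)
    (auto simp: relabel_append relabel_Node intro: occurs_in.intros)

section \<open>Lifting relations by one level\<close>

abbreviation (input) eq_under :: "('a \<Rightarrow> 'b) \<Rightarrow> 'a \<Rightarrow> 'a \<Rightarrow> bool" where
  "eq_under f \<equiv> \<lambda>x y. f x = f y"

lemma image_eq_image_iff_rel_set: "f ` A = f ` B \<longleftrightarrow> rel_set (eq_under f) A B"
  unfolding rel_set_def set_eq_iff image_iff by metis

lemma rel_set_mono_strong:
  "rel_set R A B \<Longrightarrow> (\<And>x y. x \<in> A \<Longrightarrow> y \<in> B \<Longrightarrow> R x y \<Longrightarrow> S x y) \<Longrightarrow> rel_set S A B"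
  unfolding rel_set_def by meson

lemma rel_set_obtain_list_all2:
  assumes "rel_set R (set xs) (set ys)"
  obtains xs' ys' where "set xs' = set xs" and "set ys' = set ys" and "list_all2 R xs' ys'"
proof -
  have "finite {(x, y) \<in> set xs \<times> set ys. R x y}"
    by (rule finite_subset[of _ "set xs \<times> set ys"]) auto
  then obtain ps where ps: "set ps = {(x, y) \<in> set xs \<times> set ys. R x y}"
    using finite_list by blast
  show thesis
  proof (rule that)
    show "set (map fst ps) = set xs" "set (map snd ps) = set ys"
      using assms by (auto simp: ps rel_set_def image_iff) blast+
    show "list_all2 R (map fst ps) (map snd ps)"
      unfolding list.rel_map by (rule list.rel_refl_strong) (auto simp: ps)
  qed
qed

lemma list_all2_imp_rel_set: "list_all2 R xs ys \<Longrightarrow> rel_set R (set xs) (set ys)"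
  using list.set_transfer unfolding rel_fun_def by blast

lemma rel_set_relcompp_obtain_lists:
  assumes "rel_set (P OO Q OO P\<inverse>\<inverse>) (set xs) (set ys)"
  obtains xs' ys' where "rel_set P (set xs) (set xs')" and "rel_set P (set ys) (set ys')"
    and "list_all2 Q xs' ys'"
proof -
  obtain x y where "set x = set xs" "set y = set ys" "list_all2 (P OO Q OO P\<inverse>\<inverse>) x y"
    using assms by (rule rel_set_obtain_list_all2)
  moreover from this(3) obtain xs' ys'
    where "list_all2 P x xs'" "list_all2 Q xs' ys'" "list_all2 P y ys'"
    unfolding list.rel_compp list.rel_conversep by blast
  ultimately show thesis using that list_all2_imp_rel_set by metis
qed

definition rel_node :: "('a forest \<Rightarrow> 'a forest \<Rightarrow> bool) \<Rightarrow> 'a tree \<Rightarrow> 'a tree \<Rightarrow> bool" where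
  "rel_node R t t' \<longleftrightarrow> root t = root t' \<and> R (kids t) (kids t')"

definition rel_roots :: "('a forest \<Rightarrow> 'a forest \<Rightarrow> bool) \<Rightarrow> 'a forest \<Rightarrow> 'a forest \<Rightarrow> bool" where
  "rel_roots R s s' \<longleftrightarrow> rel_set (rel_node R) (set s) (set s')"

lemma rel_roots_mono:
  assumes "rel_roots R s s'"
    and "\<And>t t'. t \<in> set s \<Longrightarrow> t' \<in> set s' \<Longrightarrow> R (kids t) (kids t') \<Longrightarrow> R' (kids t) (kids t')"
  shows "rel_roots R' s s'"
  using assms(1) unfolding rel_roots_def
  by (rule rel_set_mono_strong) (use assms(2) in \<open>auto simp: rel_node_def\<close>)

lemma rel_roots_relabel:
  "rel_roots R (relabel f s) (relabel f s') \<longleftrightarrow>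
     rel_roots (\<lambda>u u'. f u = f u' \<and> R (relabel f u) (relabel f u')) s s'"
  by (simp add: rel_roots_def rel_node_def rel_set_def set_relabel conj_assoc)

lemma roots_relabel_eq_iff:
  "root ` set (relabel f s) = root ` set (relabel f s') \<longleftrightarrow> rel_roots (eq_under f) s s'"
  by (simp add: set_relabel image_image image_eq_image_iff_rel_set rel_roots_def rel_node_def[abs_def])

lemma sim_k_refl: "sim_k k s s"
  by (cases k) auto

lemma sim_k_sym: "sim_k k s s' \<Longrightarrow> sim_k k s' s"
  by (cases k) auto

lemma sim_k_trans: "sim_k k s t \<Longrightarrow> sim_k k t u \<Longrightarrow> sim_k k s u"
  by (cases k) auto

lemma sim_k_class_eq_iff: "{u. sim_k k s u} = {u. sim_k k s' u} \<longleftrightarrow> sim_k k s s'"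
  by (blast intro: sim_k_refl sim_k_sym sim_k_trans)

lemma sim_k_Suc_iff: "sim_k (Suc k) s s' \<longleftrightarrow> rel_roots (sim_k k) s s'"
  by (simp add: image_eq_image_iff_rel_set rel_roots_def rel_node_def[abs_def] sim_k_class_eq_iff)

abbreviation sim_under :: "('a forest \<Rightarrow> 'v) \<Rightarrow> nat \<Rightarrow> 'a forest \<Rightarrow> 'a forest \<Rightarrow> bool" where
  "sim_under f k s s' \<equiv> sim_k k (relabel f s) (relabel f s')"

lemma sim_under_Suc_iff:
  "sim_under f (Suc k) s s' \<longleftrightarrow> rel_roots (\<lambda>u u'. f u = f u' \<and> sim_under f k u u') s s'"
  unfolding sim_k_Suc_iff rel_roots_relabel ..

lemma sim_under_coarsen:
  assumes "factors_through g f" and "sim_under f k s s'"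
  shows "sim_under g k s s'"
  using assms(2)
proof (induction k arbitrary: s s')
  case 0
  then show ?case by simp
next
  case (Suc k)
  show ?case
    using Suc.prems unfolding sim_under_Suc_iff
    by (rule rel_roots_mono) (use Suc.IH assms(1) in \<open>unfold factors_through_def, blast\<close>)
qed

section \<open>Homomorphisms into forest algebras\<close>

locale forest_homomorphism =
  fixes H :: "'h set" and add :: "'h \<Rightarrow> 'h \<Rightarrow> 'h" and zero :: 'h
    and V :: "('h \<Rightarrow> 'h) set" and \<alpha> :: "'a forest \<Rightarrow> 'h"
  assumes hom: "forest_hom H add zero V \<alpha>"
begin

lemma algebra: "forest_algebra H add zero V"
  using hom unfolding forest_hom_def by simp

lemma add_assoc: "f \<in> H \<Longrightarrow> g \<in> H \<Longrightarrow> h \<in> H \<Longrightarrow> add (add f g) h = add f (add g h)"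
  using algebra unfolding forest_algebra_def by simp

lemma add_zero_left: "h \<in> H \<Longrightarrow> add zero h = h"
  using algebra unfolding forest_algebra_def by simp

lemma hom_in: "\<alpha> s \<in> H"
  using hom unfolding forest_hom_def by simp

lemma hom_Nil: "\<alpha> [] = zero"
  using hom unfolding forest_hom_def by simp

lemma hom_append: "\<alpha> (s @ t) = add (\<alpha> s) (\<alpha> t)"
  using hom unfolding forest_hom_def by simp

lemma hom_Cons: "\<alpha> (t # s) = add (\<alpha> [t]) (\<alpha> s)"
  using hom_append[of "[t]" s] by simp

lemma hom_NodeE:
  obtains f where "\<And>a. f a \<in> V" and "\<And>a s. \<alpha> [Node a s] = f a (\<alpha> s)"
  using hom unfolding forest_hom_def by blast

lemma hom_tree_cong: "rel_node (eq_under \<alpha>) t t' \<Longrightarrow> \<alpha> [t] = \<alpha> [t']"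
  unfolding rel_node_def by (metis hom_NodeE Node_root_kids)

lemma reach_refl: "h \<in> H \<Longrightarrow> reach V h h"
  using algebra unfolding forest_algebra_def reach_def by metis

lemma reach_trans: "reach V f g \<Longrightarrow> reach V g h \<Longrightarrow> reach V f h"
  using algebra unfolding forest_algebra_def reach_def by (metis comp_apply)

lemma reach_add_right: "g \<in> H \<Longrightarrow> h \<in> H \<Longrightarrow> reach V (add g h) g"
  using algebra unfolding forest_algebra_def reach_def by metis

lemma reach_add_left: "g \<in> H \<Longrightarrow> h \<in> H \<Longrightarrow> reach V (add g h) h"
  using algebra unfolding forest_algebra_def reach_def by metis

lemma reach_if_occurs_in: "occurs_in u s \<Longrightarrow> reach V (\<alpha> s) (\<alpha> u)"
proof (induction rule: occurs_in.induct)
  case refl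
  show ?case using reach_refl hom_in .
next
  case (append s l r)
  have "reach V (\<alpha> (l @ s @ r)) (\<alpha> (s @ r))" "reach V (\<alpha> (s @ r)) (\<alpha> s)"
    by (simp_all only: hom_append[of l] hom_append[of s] reach_add_left reach_add_right
        hom_in hom_in[of "s @ r", unfolded hom_append])
  then show ?case using append reach_trans by blast
next
  case (Node s a)
  have "reach V (\<alpha> [Node a s]) (\<alpha> s)" using hom_NodeE unfolding reach_def by metis
  then show ?case using Node reach_trans by blast
qed

lemma reach_obtain_occurs_in:
  assumes "forest_hom_surj H V \<alpha>" and "reach V h (\<alpha> u)"
  obtains r where "occurs_in u r" and "\<alpha> r = h"
  using assms occurs_in_fill unfolding forest_hom_surj_def reach_def by metis

lemma reach_kids: "reach V g (\<alpha> s) \<Longrightarrow> t \<in> set s \<Longrightarrow> reach V g (\<alpha> (kids t))"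
  by (blast intro: reach_trans reach_if_occurs_in occurs_in_kids)

definition reach_class :: "'h \<Rightarrow> 'h set" where
  "reach_class g = {h \<in> H. reach V g h \<and> reach V h g}"

definition strictly_above :: "'h \<Rightarrow> 'h set" where
  "strictly_above g = {h \<in> H. reach V g h \<and> \<not> reach V h g}"

lemma reach_class_self: "g \<in> H \<Longrightarrow> g \<in> reach_class g"
  by (simp add: reach_class_def reach_refl)

lemma reach_class_eq: "h \<in> reach_class g \<Longrightarrow> reach_class h = reach_class g"
  unfolding reach_class_def by (blast intro: reach_trans)

lemma strictly_above_eq: "h \<in> reach_class g \<Longrightarrow> strictly_above h = strictly_above g"
  unfolding reach_class_def strictly_above_def by (blast intro: reach_trans)

lemma hom_in_reach_class_iff:
  "\<alpha> s \<in> reach_class g \<longleftrightarrow> reach V g (\<alpha> s) \<and> \<alpha> s \<notin> strictly_above g"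
  unfolding reach_class_def strictly_above_def using hom_in by blast

definition value_in :: "'h set \<Rightarrow> 'a forest \<Rightarrow> 'h option" where
  "value_in X s = (if \<alpha> s \<in> X then Some (\<alpha> s) else None)"

lemma value_in_eq_iff: "value_in X s = value_in X s' \<longleftrightarrow> \<alpha> s = \<alpha> s' \<or> \<alpha> s \<notin> X \<and> \<alpha> s' \<notin> X"
  by (auto simp: value_in_def)

lemma factors_through_value_in: "Y \<subseteq> X \<Longrightarrow> factors_through (value_in Y) (value_in X)"
  unfolding factors_through_def value_in_eq_iff by blast

abbreviation value_above :: "'h \<Rightarrow> 'a forest \<Rightarrow> 'h option" where
  "value_above g \<equiv> value_in (strictly_above g)"

definition nonconfusing_at :: "nat \<Rightarrow> 'h \<Rightarrow> bool" where
  "nonconfusing_at k g \<longleftrightarrow> (\<forall>s s'. sim_under (value_above g) k s s' \<and>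
     \<alpha> s \<in> reach_class g \<and> \<alpha> s' \<in> reach_class g \<longrightarrow> \<alpha> s = \<alpha> s')"

lemma alpha_Gamma_reach_class:
  assumes "g \<in> H"
  shows "alpha_Gamma H V (reach_class g) \<alpha> = value_above g"
proof -
  have "above V h (reach_class g) \<longleftrightarrow> h \<in> strictly_above g" if "h \<in> H" for h
    using that assms unfolding above_def reach_class_def strictly_above_def
    by (auto intro: reach_refl reach_trans)
  then show ?thesis
    by (auto simp: alpha_Gamma_def I_set_def value_in_def hom_in)
qed

lemma nonconfusing_iff: "nonconfusing H V \<alpha> \<longleftrightarrow> (\<exists>k>0. \<forall>g\<in>H. nonconfusing_at k g)"
proof -
  have "reach_classes H V = reach_class ` H"
    unfolding reach_classes_def reach_class_def by blast
  then show ?thesis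
    unfolding nonconfusing_def equiv_akG_def nonconfusing_at_def
    by (simp add: alpha_Gamma_reach_class cong: ball_cong)
qed

end

locale semilattice_forest_hom = forest_homomorphism +
  assumes idem: "\<forall>h\<in>H. add h h = h"
    and comm: "\<forall>g\<in>H. \<forall>h\<in>H. add g h = add h g"
begin

lemma add_left_commute: "f \<in> H \<Longrightarrow> g \<in> H \<Longrightarrow> h \<in> H \<Longrightarrow> add f (add g h) = add g (add f h)"
  using comm by (metis add_assoc)

lemma add_left_idem: "g \<in> H \<Longrightarrow> h \<in> H \<Longrightarrow> add g (add g h) = add g h"
  using idem by (simp add: add_assoc[symmetric])

lemma add_hom_absorb_tree:
  assumes "t \<in> set s"
  shows "add (\<alpha> [t]) (\<alpha> s) = \<alpha> s"
proof -
  obtain l r where "s = l @ t # r" using assms by (blast dest: split_list)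
  then have "\<alpha> s = add (\<alpha> [t]) (\<alpha> (l @ r))"
    by (simp add: hom_append hom_Cons[of t r] hom_in add_left_commute[of "\<alpha> l"])
  then show ?thesis by (simp add: add_left_idem hom_in)
qed

lemma add_hom_absorb:
  "(\<And>t. t \<in> set s \<Longrightarrow> \<exists>t'\<in>set s'. \<alpha> [t] = \<alpha> [t']) \<Longrightarrow> add (\<alpha> s) (\<alpha> s') = \<alpha> s'"
proof (induction s)
  case Nil
  then show ?case by (simp add: hom_Nil add_zero_left hom_in)
next
  case (Cons t s)
  have "add (\<alpha> [t]) (\<alpha> s') = \<alpha> s'"
    using Cons.prems[of t] add_hom_absorb_tree by auto
  then show ?case using Cons by (simp add: hom_Cons[of t s] add_assoc hom_in)
qed

lemma hom_cong_trees:
  assumes "rel_set (\<lambda>t t'. \<alpha> [t] = \<alpha> [t']) (set s) (set s')"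
  shows "\<alpha> s = \<alpha> s'"
proof -
  have "add (\<alpha> s) (\<alpha> s') = \<alpha> s'" "add (\<alpha> s') (\<alpha> s) = \<alpha> s"
    using assms unfolding rel_set_def by (metis add_hom_absorb)+
  then show ?thesis using comm hom_in by metis
qed

lemma hom_cong_roots: "rel_roots (eq_under \<alpha>) s s' \<Longrightarrow> \<alpha> s = \<alpha> s'"
  unfolding rel_roots_def
  by (blast intro: hom_cong_trees rel_set_mono_strong hom_tree_cong)

end

section \<open>Layers and cascades\<close>

abbreviation EF_EX_layer :: "('b forest \<Rightarrow> nat) \<Rightarrow> bool" where
  "EF_EX_layer b \<equiv> U1_hom b \<or> one_definite_hom b"

lemma U1_hom_less_2:
  assumes "U1_hom b"
  shows "b s < 2"
proof -
  have "b s \<in> {0, 1}" using assms unfolding U1_hom_def forest_hom_def by blast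
  then show ?thesis by auto
qed

lemma U1_hom_mono:
  assumes "U1_hom b" and "occurs_in u s"
  shows "b u \<le> b s"
proof -
  interpret forest_homomorphism "{0, 1}" max 0 "{id, \<lambda>g. max g 1}" b
    using assms(1) unfolding U1_hom_def by unfold_locales
  have "reach {id, \<lambda>g. max g 1} (b s) (b u)" using assms(2) by (rule reach_if_occurs_in)
  then show ?thesis by (auto simp: reach_def)
qed

lemma one_definite_hom_relabel_cong:
  "one_definite_hom b \<Longrightarrow> rel_roots (eq_under f) s s' \<Longrightarrow> b (relabel f s) = b (relabel f s')"
  unfolding roots_relabel_eq_iff[symmetric] one_definite_hom_def set_map by blast

lemma EF_EX_hom_iff_casc_rev:
  "EF_EX_hom f \<longleftrightarrow> (\<exists>bs. (\<forall>b\<in>set bs. EF_EX_layer b) \<and> factors_through f (casc_rev bs))"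
  unfolding EF_EX_hom_def cascade_def by (metis rev_rev_ident set_rev)

section \<open>\<open>(EF,EX)\<close>-homomorphisms are nonconfusing\<close>

primrec agree_modulo :: "'a forest \<Rightarrow> nat \<Rightarrow> 'a forest \<Rightarrow> 'a forest \<Rightarrow> bool" where
  "agree_modulo u 0 r r' \<longleftrightarrow> r = r' \<or> occurs_in u r \<and> occurs_in u r'"
| "agree_modulo u (Suc k) r r' \<longleftrightarrow> list_all2 (rel_node (agree_modulo u k)) r r'"

lemma agree_modulo_Suc_imp_rel_roots:
  "agree_modulo u (Suc k) r r' \<Longrightarrow> rel_roots (agree_modulo u k) r r'"
  unfolding rel_roots_def agree_modulo.simps by (rule list_all2_imp_rel_set)

lemma agree_modulo_cases:
  assumes "agree_modulo u k r r'"
  obtains (equal) "r = r'" | (occurs) "occurs_in u r" and "occurs_in u r'"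
proof -
  have "r = r' \<or> occurs_in u r \<and> occurs_in u r'"
    using assms
  proof (induction k arbitrary: r r')
    case 0
    then show ?case by simp
  next
    case (Suc k)
    from Suc.prems have "list_all2 (rel_node (agree_modulo u k)) r r'" by simp
    then show ?case
    proof induction
      case Nil
      then show ?case by simp
    next
      case (Cons t r t' r')
      have "t = t' \<or> occurs_in u (kids t) \<and> occurs_in u (kids t')"
        using Cons.hyps(1) Suc.IH unfolding rel_node_def tree_eq_iff by blast
      then show ?case
        using Cons.IH occurs_in_trans[OF occurs_in_kids] occurs_in_Cons by (metis list.set_intros(1))
    qed
  qed
  then show thesis using that by blast
qed

context forest_homomorphism
begin

text \<open>The converse \<open>reach V (\<alpha> s) (\<alpha> u)\<close> holds whenever \<open>u\<close> occurs in \<open>s\<close>.\<close>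

definition occurs_within_class :: "'a forest \<Rightarrow> 'a forest \<Rightarrow> bool" where
  "occurs_within_class u s \<longleftrightarrow> occurs_in u s \<and> reach V (\<alpha> u) (\<alpha> s)"

lemma occurs_within_class_refl: "occurs_within_class u u"
  by (simp add: occurs_within_class_def occurs_in.refl reach_refl hom_in)

lemma occurs_within_class_trans:
  "occurs_within_class u s \<Longrightarrow> occurs_within_class s t \<Longrightarrow> occurs_within_class u t"
  unfolding occurs_within_class_def by (blast intro: occurs_in_trans reach_trans)

primrec stable :: "(('a \<times> nat list) forest \<Rightarrow> nat) list \<Rightarrow> 'a forest \<Rightarrow> bool" where
  "stable [] u \<longleftrightarrow> True"
| "stable (b # bs) u \<longleftrightarrow> stable bs u \<and> (U1_hom b \<longrightarrow>
     (\<forall>s. occurs_within_class u s \<longrightarrow>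
        b (relabel (casc_rev bs) s) = b (relabel (casc_rev bs) u)))"

lemma stable_mono:
  assumes "stable bs u" and uv: "occurs_within_class u v"
  shows "stable bs v"
  using assms(1)
proof (induction bs)
  case (Cons b bs)
  let ?b = "\<lambda>s. b (relabel (casc_rev bs) s)"
  have "?b s = ?b v" if "U1_hom b" and vs: "occurs_within_class v s" for s
  proof -
    have "?b s = ?b u" using that(1) Cons.prems occurs_within_class_trans[OF uv vs] by simp
    moreover have "?b v = ?b u" using that(1) Cons.prems uv by simp
    ultimately show ?thesis by simp
  qed
  then show ?case using Cons by simp
qed simp

lemma exists_stable: "\<exists>v. occurs_within_class u v \<and> stable bs v"
proof (induction bs)
  case Nil
  show ?case using occurs_within_class_refl by auto
next
  case (Cons b bs)
  then obtain v where v: "occurs_within_class u v" "stable bs v" by blast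
  show ?case
  proof (cases "U1_hom b")
    case True
    let ?b = "\<lambda>s. b (relabel (casc_rev bs) s)"
    have "\<forall>s. occurs_within_class v s \<longrightarrow> ?b s < 2" using U1_hom_less_2[OF True] by blast
    then obtain w where vw: "occurs_within_class v w"
      and max: "\<And>s. occurs_within_class v s \<Longrightarrow> ?b s \<le> ?b w"
      using ex_has_greatest_nat[of "occurs_within_class v" v ?b 2] occurs_within_class_refl by blast
    have "?b s = ?b w" if ws: "occurs_within_class w s" for s
    proof (rule antisym)
      show "?b s \<le> ?b w" using occurs_within_class_trans[OF vw ws] by (rule max)
      have "occurs_in w s" using ws unfolding occurs_within_class_def ..
      then show "?b w \<le> ?b s" by (intro U1_hom_mono True occurs_in_relabel)
    qed
    then have "stable (b # bs) w" using stable_mono[OF v(2) vw] by simp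
    then show ?thesis using occurs_within_class_trans[OF v(1) vw] by blast
  next
    case False
    then show ?thesis using v by auto
  qed
qed

lemma casc_rev_eq_if_agree_modulo:
  assumes "agree_modulo u k r r'" and "length bs \<le> k"
    and "\<forall>b\<in>set bs. EF_EX_layer b" and "stable bs u"
    and "reach V (\<alpha> u) (\<alpha> r)" and "reach V (\<alpha> u) (\<alpha> r')"
  shows "casc_rev bs r = casc_rev bs r'"
  using assms
proof (induction bs arbitrary: k r r')
  case Nil
  then show ?case by simp
next
  case (Cons b bs)
  have "b (relabel (casc_rev bs) r) = b (relabel (casc_rev bs) r')"
    using Cons.prems(1)
  proof (cases rule: agree_modulo_cases)
    case equal
    then show ?thesis by simp
  next
    case occurs
    show ?thesis
    proof (cases "U1_hom b")
      case True
      then show ?thesis using occurs Cons.prems(4-6) by (simp add: occurs_within_class_def)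
    next
      case False
      obtain i where k: "k = Suc i" "length bs \<le> i"
        using Cons.prems(2) by (cases k) auto
      have "rel_roots (agree_modulo u i) r r'"
        using Cons.prems(1) unfolding k(1) by (rule agree_modulo_Suc_imp_rel_roots)
      then have "rel_roots (eq_under (casc_rev bs)) r r'"
        by (rule rel_roots_mono)
          (use Cons.prems k(2) in \<open>auto intro!: Cons.IH[of i] intro: reach_kids\<close>)
      moreover have "one_definite_hom b" using False Cons.prems(3) by simp
      ultimately show ?thesis by (intro one_definite_hom_relabel_cong)
    qed
  qed
  moreover have "casc_rev bs r = casc_rev bs r'" using Cons.IH Cons.prems by simp
  ultimately show ?case by simp
qed

end

context semilattice_forest_hom
begin

lemma exists_agree_modulo_0:
  assumes surj: "forest_hom_surj H V \<alpha>"
    and "reach V (\<alpha> u) (\<alpha> s)" and "reach V (\<alpha> u) (\<alpha> s')"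
    and "value_above (\<alpha> u) s = value_above (\<alpha> u) s'"
  shows "\<exists>r r'. \<alpha> r = \<alpha> s \<and> \<alpha> r' = \<alpha> s' \<and> agree_modulo u 0 r r'"
proof (cases "\<alpha> s = \<alpha> s'")
  case True
  then show ?thesis by auto
next
  case False
  then have "reach V (\<alpha> s) (\<alpha> u)" "reach V (\<alpha> s') (\<alpha> u)"
    using assms(2-4) hom_in by (auto simp: value_in_eq_iff strictly_above_def)
  then obtain r r' where "occurs_in u r" "\<alpha> r = \<alpha> s" "occurs_in u r'" "\<alpha> r' = \<alpha> s'"
    using reach_obtain_occurs_in[OF surj] by metis
  then show ?thesis by auto
qed

lemma exists_agree_modulo:
  assumes surj: "forest_hom_surj H V \<alpha>"
    and "reach V (\<alpha> u) (\<alpha> s)" and "reach V (\<alpha> u) (\<alpha> s')"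
    and "value_above (\<alpha> u) s = value_above (\<alpha> u) s'"
    and "sim_under (value_above (\<alpha> u)) k s s'"
  shows "\<exists>r r'. \<alpha> r = \<alpha> s \<and> \<alpha> r' = \<alpha> s' \<and> agree_modulo u k r r'"
  using assms(2-)
proof (induction k arbitrary: s s')
  case 0
  then show ?case using exists_agree_modulo_0[OF surj] by blast
next
  case (Suc k)
  let ?S = "\<lambda>v v'. value_above (\<alpha> u) v = value_above (\<alpha> u) v' \<and>
    sim_under (value_above (\<alpha> u)) k v v'"
  let ?P = "\<lambda>t q. \<alpha> [t] = \<alpha> [q]" and ?Q = "rel_node (agree_modulo u k)"
  have "rel_set (rel_node ?S) (set s) (set s')"
    using Suc.prems(4) unfolding sim_under_Suc_iff rel_roots_def .
  then have "rel_set (?P OO ?Q OO ?P\<inverse>\<inverse>) (set s) (set s')"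
  proof (rule rel_set_mono_strong)
    fix t t'
    assume t: "t \<in> set s" "t' \<in> set s'" and sim: "rel_node ?S t t'"
    then obtain q q' where "\<alpha> q = \<alpha> (kids t)" "\<alpha> q' = \<alpha> (kids t')" "agree_modulo u k q q'"
      using Suc.IH[of "kids t" "kids t'"] Suc.prems(1,2) reach_kids
      unfolding rel_node_def by blast
    then have "?P t (Node (root t) q)" "?Q (Node (root t) q) (Node (root t') q')"
      "?P t' (Node (root t') q')"
      using sim by (auto simp: rel_node_def intro!: hom_tree_cong)
    then show "(?P OO ?Q OO ?P\<inverse>\<inverse>) t t'" by blast
  qed
  then obtain r r'
    where "rel_set ?P (set s) (set r)" "rel_set ?P (set s') (set r')" "list_all2 ?Q r r'"
    by (rule rel_set_relcompp_obtain_lists)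
  then show ?case by (metis agree_modulo.simps(2) hom_cong_trees)
qed

lemma nonconfusing_if_EF_EX_hom:
  assumes surj: "forest_hom_surj H V \<alpha>" and "EF_EX_hom \<alpha>"
  shows "nonconfusing H V \<alpha>"
proof -
  obtain bs where bs: "\<forall>b\<in>set bs. EF_EX_layer b" and fact: "factors_through \<alpha> (casc_rev bs)"
    using assms(2) unfolding EF_EX_hom_iff_casc_rev by blast
  let ?k = "Suc (length bs)"
  have "\<alpha> s = \<alpha> s'"
    if "g \<in> H" and "\<alpha> s \<in> reach_class g" "\<alpha> s' \<in> reach_class g"
      and sim: "sim_under (value_above g) ?k s s'" for g s s'
  proof -
    obtain t where g: "g = \<alpha> t"
      using \<open>g \<in> H\<close> surj unfolding forest_hom_surj_def by blast
    obtain u where "occurs_within_class t u" and stable: "stable bs u"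
      using exists_stable by blast
    then have u: "\<alpha> u \<in> reach_class g"
      using hom_in reach_if_occurs_in by (simp add: g reach_class_def occurs_within_class_def)
    have reach_u: "reach V (\<alpha> u) (\<alpha> s)" "reach V (\<alpha> u) (\<alpha> s')"
      "\<alpha> s \<notin> strictly_above (\<alpha> u)" "\<alpha> s' \<notin> strictly_above (\<alpha> u)"
      using that(2,3) unfolding reach_class_eq[OF u, symmetric] hom_in_reach_class_iff by auto
    then obtain r r' where r: "\<alpha> r = \<alpha> s" "\<alpha> r' = \<alpha> s'" and agree: "agree_modulo u ?k r r'"
      using exists_agree_modulo[OF surj] sim
      unfolding strictly_above_eq[OF u, symmetric] value_in_eq_iff by metis
    then have "casc_rev bs r = casc_rev bs r'"
      using bs stable reach_u by (intro casc_rev_eq_if_agree_modulo[OF agree]) auto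
    then show ?thesis using fact r unfolding factors_through_def by metis
  qed
  then show ?thesis unfolding nonconfusing_iff nonconfusing_at_def by blast
qed

end

section \<open>Closure properties of \<open>(EF,EX)\<close>-homomorphisms\<close>

lemma factors_through_trans:
  "factors_through h g \<Longrightarrow> factors_through g f \<Longrightarrow> factors_through h f"
  unfolding factors_through_def by blast

lemma EF_EX_hom_factor: "EF_EX_hom f \<Longrightarrow> factors_through g f \<Longrightarrow> EF_EX_hom g"
  unfolding EF_EX_hom_def using factors_through_trans by blast

lemma EF_EX_homE:
  assumes "EF_EX_hom f"
  obtains bs F where "\<forall>b\<in>set bs. EF_EX_layer b" and "f = F \<circ> casc_rev bs"
  using assms unfolding EF_EX_hom_iff_casc_rev factors_through_def function_factors_left by blast

definition roots_layer :: "'b::countable forest \<Rightarrow> nat" where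
  "roots_layer s = set_encode (to_nat ` root ` set s)"

lemma roots_layer_eq_iff: "roots_layer s = roots_layer s' \<longleftrightarrow> root ` set s = root ` set s'"
  unfolding roots_layer_def by (simp add: set_encode_eq inj_image_eq_iff)

lemma one_definite_roots_layer: "one_definite_hom (roots_layer :: 'b::countable forest \<Rightarrow> nat)"
  unfolding one_definite_hom_def
proof (intro conjI exI allI impI)
  let ?add = "\<lambda>m n. set_encode (set_decode m \<union> set_decode n)"
  show "forest_hom UNIV ?add 0 UNIV (roots_layer :: 'b forest \<Rightarrow> nat)"
    unfolding forest_hom_def
  proof (intro conjI)
    show "forest_algebra UNIV ?add 0 UNIV"
      unfolding forest_algebra_def by (auto simp: Un_assoc)
    show "\<exists>f. (\<forall>a. f a \<in> UNIV) \<and>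
        (\<forall>a s. (roots_layer :: 'b forest \<Rightarrow> nat) [Node a s] = f a (roots_layer s))"
      by (rule exI[of _ "\<lambda>a _. set_encode {to_nat a}"]) (simp add: roots_layer_def)
  qed (auto simp: roots_layer_def image_Un)
qed (simp add: roots_layer_eq_iff)

lemma EF_EX_hom_roots:
  fixes f :: "('a::countable) forest \<Rightarrow> 'v"
  assumes "EF_EX_hom f"
  shows "EF_EX_hom (\<lambda>s. (f s, root ` set (relabel f s)))"
proof -
  obtain bs F where bs: "\<forall>b\<in>set bs. EF_EX_layer b" and f: "f = F \<circ> casc_rev bs"
    using assms by (rule EF_EX_homE)
  have "factors_through (\<lambda>s. (f s, root ` set (relabel f s))) (casc_rev (roots_layer # bs))"
    unfolding factors_through_def f roots_relabel_comp by (simp add: roots_layer_eq_iff)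
  moreover have "\<forall>b\<in>set (roots_layer # bs). EF_EX_layer b"
    using bs by (simp add: one_definite_roots_layer)
  ultimately show ?thesis unfolding EF_EX_hom_iff_casc_rev by blast
qed

definition labels_meet_layer :: "'b set \<Rightarrow> 'b forest \<Rightarrow> nat" where
  "labels_meet_layer B s = (if labels s \<inter> B = {} then 0 else 1)"

lemma U1_labels_meet_layer: "U1_hom (labels_meet_layer B)"
  unfolding U1_hom_def forest_hom_def
proof (intro conjI)
  show "forest_algebra {0, 1} max 0 {id, \<lambda>g::nat. max g 1}"
    unfolding forest_algebra_def by (auto simp: fun_eq_iff max.assoc)
  show "\<exists>f. (\<forall>a. f a \<in> {id, \<lambda>g::nat. max g 1}) \<and>
      (\<forall>a s. labels_meet_layer B [Node a s] = f a (labels_meet_layer B s))"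
    by (rule exI[of _ "\<lambda>a. if a \<in> B then (\<lambda>g. max g 1) else id"])
      (auto simp: labels_meet_layer_def labels_Node)
  show "labels_meet_layer B [] = 0" by (simp add: labels_meet_layer_def labels_def)
qed (auto simp: labels_meet_layer_def labels_append)

lemma EF_EX_hom_labels_meet:
  assumes "EF_EX_hom f"
  shows "EF_EX_hom (\<lambda>s. (f s, labels (relabel f s) \<inter> B = {}))"
proof -
  obtain bs F where bs: "\<forall>b\<in>set bs. EF_EX_layer b" and f: "f = F \<circ> casc_rev bs"
    using assms by (rule EF_EX_homE)
  let ?b = "labels_meet_layer (map_prod id F -` B)"
  have "labels (relabel f s) \<inter> B = {} \<longleftrightarrow> ?b (relabel (casc_rev bs) s) = 0" for s
    unfolding f labels_relabel_comp labels_meet_layer_def by auto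
  then have "factors_through (\<lambda>s. (f s, labels (relabel f s) \<inter> B = {})) (casc_rev (?b # bs))"
    unfolding factors_through_def by (simp add: f)
  moreover have "\<forall>b\<in>set (?b # bs). EF_EX_layer b"
    using bs by (simp add: U1_labels_meet_layer)
  ultimately show ?thesis unfolding EF_EX_hom_iff_casc_rev by blast
qed

lemma EF_EX_hom_sim_k:
  fixes f :: "('a::countable) forest \<Rightarrow> 'v"
  assumes "EF_EX_hom f"
  shows "EF_EX_hom (\<lambda>s. (f s, {u. sim_k k (relabel f s) u}))"
proof (induction k)
  case 0
  show ?case by (rule EF_EX_hom_factor[OF assms]) (simp add: factors_through_def)
next
  case (Suc k)
  show ?case
  proof (rule EF_EX_hom_factor[OF EF_EX_hom_roots[OF Suc]])
    show "factors_through (\<lambda>s. (f s, {u. sim_k (Suc k) (relabel f s) u}))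
      (\<lambda>s. ((f s, {u. sim_k k (relabel f s) u}),
        root ` set (relabel (\<lambda>s. (f s, {u. sim_k k (relabel f s) u})) s)))"
      unfolding factors_through_def prod.inject roots_relabel_eq_iff sim_k_class_eq_iff
      unfolding sim_under_Suc_iff by blast
  qed
qed

text \<open>A forest outside \<open>G\<close> contains a minimal one, whose value under \<open>f\<close> is not taken on \<open>G\<close>.\<close>

lemma EF_EX_hom_mem:
  assumes "EF_EX_hom f"
    and kids: "\<And>s t. s \<in> G \<Longrightarrow> t \<in> set s \<Longrightarrow> kids t \<in> G"
    and separates: "\<And>s s'. s \<notin> G \<Longrightarrow> (\<And>t. t \<in> set s \<Longrightarrow> kids t \<in> G) \<Longrightarrow> s' \<in> G \<Longrightarrow> f s \<noteq> f s'"
  shows "EF_EX_hom (\<lambda>s. (f s, s \<in> G))"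
proof -
  let ?B = "UNIV \<times> - f ` G"
  let ?U = "\<lambda>s. labels (relabel f s) \<inter> ?B"
  have U_eq_empty: "?U s = {} \<longleftrightarrow> (\<forall>t\<in>set s. f (kids t) \<in> f ` G \<and> ?U (kids t) = {})" for s
    unfolding labels_relabel[of f s] by auto
  have "?U s = {}" if "s \<in> G" for s
    using that
  proof (induction s rule: forest_induct)
    case (forest s)
    then show ?case unfolding U_eq_empty[of s] using kids by blast
  qed
  moreover have "s \<in> G" if "f s \<in> f ` G" "?U s = {}" for s
    using that
  proof (induction s rule: forest_induct)
    case (forest s)
    then have "kids t \<in> G" if "t \<in> set s" for t
      using that unfolding U_eq_empty[of s] by blast
    then show ?case using forest.prems(1) separates by blast
  qed
  ultimately have "s \<in> G \<longleftrightarrow> f s \<in> f ` G \<and> ?U s = {}" for s by blast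
  then have "factors_through (\<lambda>s. (f s, s \<in> G)) (\<lambda>s. (f s, ?U s = {}))"
    unfolding factors_through_def prod.inject by metis
  then show ?thesis by (rule EF_EX_hom_factor[OF EF_EX_hom_labels_meet[OF assms(1)]])
qed

lemma EF_EX_hom_mem_if_roots_separate:
  fixes f :: "('a::countable) forest \<Rightarrow> 'v"
  assumes "EF_EX_hom f"
    and kids: "\<And>s t. s \<in> G \<Longrightarrow> t \<in> set s \<Longrightarrow> kids t \<in> G"
    and separates: "\<And>s s'. s \<notin> G \<Longrightarrow> (\<And>t. t \<in> set s \<Longrightarrow> kids t \<in> G) \<Longrightarrow> s' \<in> G \<Longrightarrow>
      \<not> rel_roots (eq_under f) s s'"
  shows "EF_EX_hom (\<lambda>s. (f s, s \<in> G))"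
proof -
  have "EF_EX_hom (\<lambda>s. ((f s, root ` set (relabel f s)), s \<in> G))"
  proof (rule EF_EX_hom_mem[OF EF_EX_hom_roots[OF assms(1)] kids])
    show "(f s, root ` set (relabel f s)) \<noteq> (f s', root ` set (relabel f s'))"
      if "s \<notin> G" "\<And>t. t \<in> set s \<Longrightarrow> kids t \<in> G" "s' \<in> G" for s s'
      using separates[OF that] unfolding roots_relabel_eq_iff[symmetric] by blast
  qed
  then show ?thesis by (rule EF_EX_hom_factor) (simp add: factors_through_def)
qed

section \<open>Nonconfusing homomorphisms are \<open>(EF,EX)\<close>-homomorphisms\<close>

context forest_homomorphism
begin

lemma hom_eq_if_sim_under_value_in:
  assumes nonconf: "nonconfusing_at k g" and X: "strictly_above g \<subseteq> X"
    and "reach V g (\<alpha> s)" "reach V g (\<alpha> s')"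
    and "value_in X s = value_in X s'" "sim_under (value_in X) k s s'"
  shows "\<alpha> s = \<alpha> s'"
proof (cases "\<alpha> s \<in> reach_class g \<and> \<alpha> s' \<in> reach_class g")
  case True
  moreover have "sim_under (value_above g) k s s'"
    using factors_through_value_in[OF X] assms(6) by (rule sim_under_coarsen)
  ultimately show ?thesis using nonconf unfolding nonconfusing_at_def by blast
next
  case False
  then have "\<alpha> s \<in> X \<or> \<alpha> s' \<in> X"
    using assms(3,4) X by (auto simp: hom_in_reach_class_iff)
  then show ?thesis using assms(5) by (auto simp: value_in_eq_iff)
qed

lemma exists_maximal_outside:
  assumes "finite H" and "X \<subset> H"
  obtains g where "g \<in> H - X" and "strictly_above g \<subseteq> X"
proof -
  let ?R = "\<lambda>g h. reach V g h \<and> \<not> reach V h g"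
  have "asymp_on (H - X) ?R" "transp_on (H - X) ?R"
    by (auto intro!: asymp_onI transp_onI dest: reach_trans)
  then obtain g where "g \<in> H - X" and "\<forall>h\<in>H - X. h \<noteq> g \<longrightarrow> \<not> ?R g h"
    using Finite_Set.bex_max_element[of "H - X" ?R] assms by blast
  then show thesis by (intro that) (auto simp: strictly_above_def)
qed

end

locale countable_semilattice_forest_hom = semilattice_forest_hom H add zero V \<alpha>
  for H :: "'h set" and add zero V and \<alpha> :: "('a::countable) forest \<Rightarrow> 'h"
begin

lemma EF_EX_hom_value_in_Un_reach_class:
  assumes nonconf: "nonconfusing_at k g" and X: "strictly_above g \<subseteq> X"
    and EF_EX: "EF_EX_hom (value_in X)"
  shows "EF_EX_hom (value_in (X \<union> reach_class g))"
proof -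
  let ?f = "\<lambda>s. (value_in X s, {u. sim_k k (relabel (value_in X) s) u})"
  let ?G = "{s. reach V g (\<alpha> s)}"
  have hom_eq: "\<alpha> s = \<alpha> s'" if "s \<in> ?G" "s' \<in> ?G" "?f s = ?f s'" for s s'
    using that hom_eq_if_sim_under_value_in[OF nonconf X]
    unfolding prod.inject sim_k_class_eq_iff by blast
  have "EF_EX_hom (\<lambda>s. (?f s, s \<in> ?G))"
  proof (rule EF_EX_hom_mem_if_roots_separate)
    show "EF_EX_hom ?f" using EF_EX by (rule EF_EX_hom_sim_k)
    show "kids t \<in> ?G" if "s \<in> ?G" "t \<in> set s" for s t
      using that reach_kids by simp
    show "\<not> rel_roots (eq_under ?f) s s'"
      if s: "s \<notin> ?G" and kids: "\<And>t. t \<in> set s \<Longrightarrow> kids t \<in> ?G" and s': "s' \<in> ?G" for s s'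
    proof
      assume "rel_roots (eq_under ?f) s s'"
      then have "rel_roots (eq_under \<alpha>) s s'"
        by (rule rel_roots_mono) (use kids s' reach_kids hom_eq in blast)
      then have "\<alpha> s = \<alpha> s'" by (rule hom_cong_roots)
      then show False using s s' by simp
    qed
  qed
  moreover have "value_in (X \<union> reach_class g) s = value_in (X \<union> reach_class g) s'"
    if "?f s = ?f s'" "s \<in> ?G \<longleftrightarrow> s' \<in> ?G" for s s'
  proof (cases "s \<in> ?G")
    case True
    then show ?thesis using that hom_eq[of s s'] by (simp add: value_in_eq_iff)
  next
    case False
    then show ?thesis using that by (auto simp: value_in_eq_iff hom_in_reach_class_iff)
  qed
  then have "factors_through (value_in (X \<union> reach_class g)) (\<lambda>s. (?f s, s \<in> ?G))"
    unfolding factors_through_def by blast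
  ultimately show ?thesis by (rule EF_EX_hom_factor)
qed

lemma EF_EX_hom_if_nonconfusing:
  assumes "finite H" and "nonconfusing H V \<alpha>"
  shows "EF_EX_hom \<alpha>"
proof -
  obtain k where k: "\<forall>g\<in>H. nonconfusing_at k g"
    using assms(2) unfolding nonconfusing_iff by blast
  let ?S = "{X. X \<subseteq> H \<and> EF_EX_hom (value_in X)}"
  have "EF_EX_hom (value_in {})"
    unfolding EF_EX_hom_iff_casc_rev factors_through_def value_in_def by (auto intro: exI[of _ "[]"])
  then have "finite ?S" "?S \<noteq> {}" using assms(1) by auto
  then have "\<exists>X\<in>?S. \<forall>Y\<in>?S. X \<subseteq> Y \<longrightarrow> X = Y" by (rule finite_has_maximal)
  then obtain X where X: "X \<in> ?S" and max: "\<forall>Y\<in>?S. X \<subseteq> Y \<longrightarrow> X = Y" ..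
  have "X = H"
  proof (rule ccontr)
    assume "X \<noteq> H"
    then obtain g where g: "g \<in> H - X" "strictly_above g \<subseteq> X"
      using X exists_maximal_outside[OF assms(1)] by blast
    have "X \<union> reach_class g \<in> ?S"
      using g X k EF_EX_hom_value_in_Un_reach_class by (auto simp: reach_class_def)
    then have "X = X \<union> reach_class g" using max by blast
    then show False using g(1) reach_class_self by blast
  qed
  moreover have "factors_through \<alpha> (value_in H)"
    unfolding factors_through_def value_in_eq_iff by (simp add: hom_in)
  ultimately show ?thesis using X EF_EX_hom_factor by blast
qed

end

theorem theorem3:
  fixes H :: "'h set" and add :: "'h \<Rightarrow> 'h \<Rightarrow> 'h" and zero :: 'h
    and V :: "('h \<Rightarrow> 'h) set" and \<alpha> :: "('a::finite) forest \<Rightarrow> 'h"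
  assumes hom: "forest_hom H add zero V \<alpha>"
    and surj: "forest_hom_surj H V \<alpha>"
    and fin: "finite H"
    and idem: "\<forall>h\<in>H. add h h = h"
    and comm: "\<forall>g\<in>H. \<forall>h\<in>H. add g h = add h g"
  shows "EF_EX_hom \<alpha> \<longleftrightarrow> nonconfusing H V \<alpha>"
proof -
  interpret countable_semilattice_forest_hom H add zero V \<alpha>
    using hom idem comm by unfold_locales
  show ?thesis
  proof
    show "nonconfusing H V \<alpha>" if "EF_EX_hom \<alpha>"
      using surj that by (rule nonconfusing_if_EF_EX_hom)
    show "EF_EX_hom \<alpha>" if "nonconfusing H V \<alpha>"
      using fin that by (rule EF_EX_hom_if_nonconfusing)
  qed
qed

end
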